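(* Let $a=(a_0,a_1,\dots)\in\mathbb{R}^{\mathbb{N}}$ and suppose the generating function $G[a](x)=\sum_{k\ge0}a_kx^k$ is a rational function of degree $d$. Then for every $t\in\mathbb{N}$ with $t\ge d$, $$\mathsf{space}_a(t)=d,$$ and for every $t\in\mathbb{N}$ with $t<d$, $$\mathsf{space}_a(t;t+d-1)=t+1.$$
   Context: Indices start at $0$, $\mathbb{N}=\{0,1,2,\dots\}$. For $a\in\mathbb{R}^{\mathbb{N}}$, $T[a]$ is the lower-triangular Toeplitz matrix with $T_{i,j}=a_{i-j}$ for $i\ge j$ and $T_{i,j}=0$ for $i<j$. Streaming model: a streaming algorithm consists of a buffer size function $\beta:\{-1\}\cup\mathbb{N}\to\mathbb{N}$ with $\beta(-1)=1$ and maps $u^{(t)}:\mathbb{R}^{\beta(t-1)}\times\mathbb{R}\to\mathbb{R}^{\beta(t)}$, $m^{(t)}:\mathbb{R}^{\beta(t)}\to\mathbb{R}$. On input $z\in\mathbb{R}^{\mathbb{N}}$, $s^{(-1)}=0\in\mathbb{R}$, $s^{(t)}=u^{(t)}(s^{(t-1)},z_t)$, output at time $t$ is $m^{(t)}(s^{(t)})$. For each $t$ the map $(z_0,\dots,z_t)\mapsto s^{(t)}$ must be continuous (output maps need not be). The algorithm computes a matrix $M$ correctly up to time $\tau$ if $m^{(t)}(s^{(t)})=(Mz)_t$ for all $z$ and all $t\le\tau$. $\mathsf{space}_M(t;\tau)$ (for $\tau\ge t$, possibly $\tau=\infty$) is the minimum $b$ such that some streaming algorithm computes $M$ correctly up to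 time $\tau$ with $\max_{t'\le t}\beta(t')\le b$; $\mathsf{space}_M(t)=\mathsf{space}_M(t;\infty)$, and $\mathsf{space}_a(t;\tau)=\mathsf{space}_{T[a]}(t;\tau)$. A polynomial $Q(x)=\sum_{k=0}^d q_kx^k$ with $q_d\neq0$ has degree $d$ and is invertible if $q_0\ne0$. A formal power series $G$ is rational of degree at most $d$ if there are polynomials $P,Q$ with $Q$ invertible, $\deg Q\le d$, $\deg P\le d-1$, and $Q\cdot G=P$; it has degree $d$ if it is of degree at most $d$ but not of degree at most $d-1$. *)

theory Defs
  imports
    "HOL-Analysis.Analysis"
    "HOL-Computational_Algebra.Computational_Algebra"
    "HOL-Library.Extended_Nat"
begin

definition toeplitz :: "(nat \<Rightarrow> real) \<Rightarrow> nat \<Rightarrow> nat \<Rightarrow> real" where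
  "toeplitz a i j = (if j \<le> i then a (i - j) else 0)"

(* Meant for matrices with finitely supported rows (e.g. lower-triangular ones),
   for which the series is a finite sum. *)
definition mat_apply :: "(nat \<Rightarrow> nat \<Rightarrow> real) \<Rightarrow> (nat \<Rightarrow> real) \<Rightarrow> nat \<Rightarrow> real" where
  "mat_apply M z i = (\<Sum>j. M i j * z j)"

text \<open>
  The space R^n is represented, as in \<^const>\<open>Euclidean_space\<close>, by the sequences
  that vanish from index n on, with the product topology.
  The field \<open>bufsize\<close> holds the buffer sizes at times 0, 1, ...; the buffer at time -1
  always has size 1 and content 0.
\<close>

record stream_alg =
  bufsize :: "nat \<Rightarrow> nat"
  update :: "nat \<Rightarrow> (nat \<Rightarrow> real) \<Rightarrow> real \<Rightarrow> (nat \<Rightarrow> real)"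
  readout :: "nat \<Rightarrow> (nat \<Rightarrow> real) \<Rightarrow> real"

definition prev_bufsize :: "stream_alg \<Rightarrow> nat \<Rightarrow> nat" where
  "prev_bufsize A t = (case t of 0 \<Rightarrow> 1 | Suc t' \<Rightarrow> bufsize A t')"

primrec buffer :: "stream_alg \<Rightarrow> (nat \<Rightarrow> real) \<Rightarrow> nat \<Rightarrow> (nat \<Rightarrow> real)" where
  "buffer A z 0 = update A 0 (\<lambda>_. 0) (z 0)"
| "buffer A z (Suc t) = update A (Suc t) (buffer A z t) (z (Suc t))"

(* Since buffer A z t depends on z 0, ..., z t only, the map from (z 0, ..., z t) to the buffer
   at time t is z \<mapsto> buffer A z t restricted to R^(t+1). *)
definition streaming_algorithm :: "stream_alg \<Rightarrow> bool" where
  "streaming_algorithm A \<longleftrightarrow>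
     (\<forall>t. \<forall>s \<in> topspace (Euclidean_space (prev_bufsize A t)). \<forall>x.
        update A t s x \<in> topspace (Euclidean_space (bufsize A t))) \<and>
     (\<forall>t. continuous_map (Euclidean_space (Suc t)) (Euclidean_space (bufsize A t))
        (\<lambda>z. buffer A z t))"

definition computes_upto :: "stream_alg \<Rightarrow> (nat \<Rightarrow> nat \<Rightarrow> real) \<Rightarrow> enat \<Rightarrow> bool" where
  "computes_upto A M \<tau> \<longleftrightarrow>
     (\<forall>z t. enat t \<le> \<tau> \<longrightarrow> readout A t (buffer A z t) = mat_apply M z t)"

(* The infimum is a minimum whenever some algorithm computes M up to time \<tau>,
   and \<infinity> otherwise. The buffer at time -1 is not counted. *)
definition min_space :: "(nat \<Rightarrow> nat \<Rightarrow> real) \<Rightarrow> nat \<Rightarrow> enat \<Rightarrow> enat" where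
  "min_space M t \<tau> = Inf {enat b | b. \<exists>A. streaming_algorithm A \<and> computes_upto A M \<tau> \<and>
     Max (bufsize A ` {..t}) \<le> b}"

(* The bound d is an integer so that d = 0 forces P = 0, and d = -1 is impossible. *)
definition rational_degree_at_most :: "real fps \<Rightarrow> int \<Rightarrow> bool" where
  "rational_degree_at_most G d \<longleftrightarrow>
     (\<exists>P Q :: real poly. coeff Q 0 \<noteq> 0 \<and> int (degree Q) \<le> d \<and>
        (P = 0 \<or> int (degree P) \<le> d - 1) \<and> fps_of_poly Q * G = fps_of_poly P)"

definition rational_of_degree :: "real fps \<Rightarrow> nat \<Rightarrow> bool" where
  "rational_of_degree G d \<longleftrightarrow>
     rational_degree_at_most G (int d) \<and> \<not> rational_degree_at_most G (int d - 1)"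

end

theory Submission
  imports "HOL-Homology.Invariance_of_Domain" Defs
begin

text \<open>
  Rationality of degree at most d is a linear recurrence of order d for a. Hence the outputs that
  the past inputs would cause at times t, ..., t+d-1 if only zeros followed form a state of size d
  that can be updated from one step to the next; storing all inputs gives the bound t+1.

  Conversely, an algorithm that is correct up to time t+d-1 recovers these d outputs from its
  buffer at time t. As functions of the inputs z 0, ..., z t they are given by t+1 columns of the
  d by d Hankel matrix of a. Minimality of d makes this matrix nonsingular, so for t < d the buffer
  is an injective continuous function of t+1 real inputs, and invariance of domain shows that its
  dimension is at least t+1.
\<close>

section \<open>Dimension bound for continuous injections between Euclidean spaces\<close>

lemma continuous_map_Euclidean_space_projection:
  "continuous_map (Euclidean_space n) euclideanreal (\<lambda>x. x i)"
  unfolding Euclidean_space_def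
  by (intro continuous_map_from_subtopology continuous_map_product_projection) simp

text \<open>If \<open>n < m\<close>, the target is a coordinate subspace of the source, so
  invariance of domain would make the image open in the larger space. A proper coordinate subspace
  contains no nonempty open set.\<close>

lemma continuous_injective_Euclidean_space_dim_le:
  assumes f: "continuous_map (Euclidean_space m) (Euclidean_space n) f"
    and inj: "inj_on f (topspace (Euclidean_space m))"
  shows "m \<le> n"
proof (rule ccontr)
  assume "\<not> m \<le> n"
  then have nm: "n < m" by simp
  let ?E = "Euclidean_space m"
  let ?U = "f ` topspace ?E"
  have fim: "f ` topspace ?E \<subseteq> topspace (Euclidean_space n)"
    using f by (auto simp: continuous_map_def)
  have En: "Euclidean_space n = subtopology ?E (topspace (Euclidean_space n))"
  proof -
    have "{x :: nat \<Rightarrow> real. \<forall>i\<ge>m. x i = 0} \<inter> {x. \<forall>i\<ge>n. x i = 0} = {x. \<forall>i\<ge>n. x i = 0}"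
      using nm by auto
    then show ?thesis
      by (simp add: Euclidean_space_def subtopology_subtopology)
  qed
  have "continuous_map ?E ?E f"
    using f by (subst (asm) En) (rule continuous_map_into_fulltopology)
  then have opn: "openin ?E ?U"
    using invariance_of_domain_Euclidean_space [of m "topspace ?E" f] inj by simp
  define p where "p = f (\<lambda>_. 0)"
  have pU: "p \<in> ?U"
    by (auto simp: p_def topspace_Euclidean_space)
  then have p0: "p i = 0" if "n \<le> i" for i
    using fim that by (auto simp: topspace_Euclidean_space)
  \<comment> \<open>This is the line through the image point \<open>p\<close> along coordinate
    \<open>n\<close>, a direction transverse to the target. It meets the image only at
    \<open>r = 0\<close>, so openness of the image would make the singleton of 0 open in the
    reals.\<close>
  define g where "g r = (\<lambda>i. if i < m then (if i = n then r else p i) else 0)" for r :: real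
  have g: "continuous_map euclideanreal ?E g"
    unfolding g_def continuous_map_componentwise_Euclidean_space
    by (auto intro: continuous_intros)
  have g0: "g 0 = p"
    using nm p0 by (auto simp: g_def fun_eq_iff)
  have "g r \<in> ?U \<longleftrightarrow> r = 0" for r
  proof
    assume "g r \<in> ?U"
    then have "g r n = 0" using fim by (auto simp: topspace_Euclidean_space)
    then show "r = 0" using nm by (simp add: g_def)
  qed (use g0 pU in simp)
  then have "{r \<in> topspace euclideanreal. g r \<in> ?U} = {0}" by auto
  then have "open {0::real}"
    using openin_continuous_map_preimage [OF g opn] by simp
  then show False using not_open_singleton by blast
qed

section \<open>Rationality, linear recurrences and the Hankel matrix\<close>

lemma fps_nth_poly_mult_shift:
  fixes Q :: "real poly"
  assumes "degree Q \<le> d"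
  shows "fps_nth (fps_of_poly Q * Abs_fps a) (n + d) = (\<Sum>l\<le>d. coeff Q (d - l) * a (n + l))"
proof -
  have "fps_nth (fps_of_poly Q * Abs_fps a) (n + d) = (\<Sum>i=0..n+d. coeff Q i * a (n + d - i))"
    by (simp add: fps_mult_nth)
  also have "\<dots> = (\<Sum>i\<le>d. coeff Q i * a (n + d - i))"
    by (rule sum.mono_neutral_right) (use assms in \<open>auto intro: coeff_eq_0\<close>)
  also have "\<dots> = (\<Sum>l\<le>d. coeff Q (d - l) * a (n + l))"
    by (rule sum.reindex_bij_witness [of _ "\<lambda>l. d - l" "\<lambda>l. d - l"]) auto
  finally show ?thesis .
qed

text \<open>The product of \<open>Q\<close> with the series is a polynomial of degree below
  \<open>d\<close> exactly when its coefficients from index \<open>d\<close> on vanish. Since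
  \<open>coeff Q 0\<close> is nonzero, each vanishing coefficient can be solved for
  \<open>a (n + d)\<close>, the latest term in its window.\<close>

lemma rational_degree_at_most_iff_recurrence:
  "rational_degree_at_most (Abs_fps a) (int d) \<longleftrightarrow>
     (\<exists>q. \<forall>n. a (n + d) = (\<Sum>l<d. q l * a (n + l)))"
proof
  assume "rational_degree_at_most (Abs_fps a) (int d)"
  then obtain P Q :: "real poly" where Q: "coeff Q 0 \<noteq> 0" "degree Q \<le> d"
    and P: "P = 0 \<or> int (degree P) \<le> int d - 1" and PQ: "fps_of_poly Q * Abs_fps a = fps_of_poly P"
    by (auto simp: rational_degree_at_most_def)
  have "a (n + d) = (\<Sum>l<d. (- coeff Q (d - l) / coeff Q 0) * a (n + l))" for n
  proof -
    have "coeff P (n + d) = 0"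
      using P by (auto intro: coeff_eq_0)
    then have "(\<Sum>l\<le>d. coeff Q (d - l) * a (n + l)) = 0"
      using fps_nth_poly_mult_shift [OF Q(2), of a n] PQ by simp
    then have "coeff Q 0 * a (n + d) = - (\<Sum>l<d. coeff Q (d - l) * a (n + l))"
      by (simp add: lessThan_Suc_atMost [symmetric])
    then have "a (n + d) = - (\<Sum>l<d. coeff Q (d - l) * a (n + l)) / coeff Q 0"
      using Q(1) by (simp add: field_simps)
    then show ?thesis
      by (simp add: sum_divide_distrib sum_negf [symmetric])
  qed
  then show "\<exists>q. \<forall>n. a (n + d) = (\<Sum>l<d. q l * a (n + l))"
    by (intro exI [of _ "\<lambda>l. - coeff Q (d - l) / coeff Q 0"] allI)
next
  assume "\<exists>q. \<forall>n. a (n + d) = (\<Sum>l<d. q l * a (n + l))"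
  then obtain q where q: "\<And>n. a (n + d) = (\<Sum>l<d. q l * a (n + l))" by blast
  \<comment> \<open>\<open>Q\<close> is the reversed characteristic polynomial of the recurrence,
    with constant coefficient 1. \<open>P\<close> collects the coefficients of the product below
    index \<open>d\<close>, the only ones that the recurrence does not annihilate.\<close>
  define Q where "Q = Poly (map (\<lambda>k. if k = 0 then 1 else - q (d - k)) [0..<Suc d])"
  define P where "P = Poly (map (\<lambda>k. fps_nth (fps_of_poly Q * Abs_fps a) k) [0..<d])"
  have cQ: "coeff Q k = (if k = 0 then 1 else if k \<le> d then - q (d - k) else 0)" for k
    by (auto simp: Q_def nth_default_def simp del: upt_Suc)
  have cP: "coeff P k = (if k < d then fps_nth (fps_of_poly Q * Abs_fps a) k else 0)" for k
    by (auto simp: P_def nth_default_def)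
  have dQ: "degree Q \<le> d"
    by (rule degree_le) (simp add: cQ)
  have dP: "P = 0 \<or> int (degree P) \<le> int d - 1"
  proof (cases d)
    case 0
    then show ?thesis by (simp add: P_def)
  next
    case (Suc d')
    then have "degree P \<le> d'" by (intro degree_le) (auto simp: cP)
    with Suc show ?thesis by simp
  qed
  have zero: "fps_nth (fps_of_poly Q * Abs_fps a) (n + d) = 0" for n
  proof -
    have "(\<Sum>l<d. coeff Q (d - l) * a (n + l)) = (\<Sum>l<d. - (q l * a (n + l)))"
      by (rule sum.cong) (auto simp: cQ)
    then show ?thesis
      by (simp add: fps_nth_poly_mult_shift [OF dQ] lessThan_Suc_atMost [symmetric] q [of n] cQ sum_negf)
  qed
  have "fps_of_poly Q * Abs_fps a = fps_of_poly P"
  proof (rule fps_ext)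
    fix k
    show "fps_nth (fps_of_poly Q * Abs_fps a) k = fps_nth (fps_of_poly P) k"
      using zero [of "k - d"] by (cases "k < d") (auto simp: cP)
  qed
  then show "rational_degree_at_most (Abs_fps a) (int d)"
    unfolding rational_degree_at_most_def using dQ dP cQ [of 0] by (intro exI [of _ P] exI [of _ Q]) auto
qed

lemma rational_degree_at_most_mono:
  "rational_degree_at_most G d \<Longrightarrow> d \<le> e \<Longrightarrow> rational_degree_at_most G e"
  unfolding rational_degree_at_most_def by (elim exE) (intro exI, auto)

text \<open>A kernel vector of the \<open>d\<close> by \<open>d\<close> Hankel matrix annihilates
  all later windows of \<open>a\<close> too, because the recurrence expresses each later row through
  earlier ones. Solving for its last nonzero entry gives a recurrence of order below
  \<open>d\<close>, against the minimality of \<open>d\<close>.\<close>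

lemma Hankel_nonsingular:
  assumes G: "rational_of_degree (Abs_fps a) d"
    and c: "\<And>i. i < d \<Longrightarrow> (\<Sum>l<d. c l * a (i + l)) = 0"
    and "l < d"
  shows "c l = 0"
proof (rule ccontr)
  assume "c l \<noteq> 0"
  \<comment> \<open>\<open>L\<close> becomes the order of the shorter recurrence: \<open>c L\<close>
    can be divided by, and no entry beyond it contributes.\<close>
  define L where "L = Max {l. l < d \<and> c l \<noteq> 0}"
  have "L \<in> {l. l < d \<and> c l \<noteq> 0}"
    unfolding L_def by (rule Max_in) (use \<open>c l \<noteq> 0\<close> \<open>l < d\<close> in auto)
  then have L: "L < d" "c L \<noteq> 0" by auto
  have above: "c l = 0" if "L < l" "l < d" for l
    using Max_ge [of "{l. l < d \<and> c l \<noteq> 0}" l] that by (fastforce simp: L_def)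
  obtain q where q: "\<And>n. a (n + d) = (\<Sum>l<d. q l * a (n + l))"
    using G rational_degree_at_most_iff_recurrence [of a d] by (auto simp: rational_of_degree_def)
  have c0: "(\<Sum>l<d. c l * a (i + l)) = 0" for i
  proof (induction i rule: less_induct)
    case (less i)
    show ?case
    proof (cases "i < d")
      \<comment> \<open>Row \<open>i = n + d\<close> is the combination with weights
        \<open>q k\<close> of the rows \<open>n + k\<close>, all of index below \<open>i\<close>.
        Exchanging the two sums exposes the induction hypothesis.\<close>
      case False
      define n where "n = i - d"
      have i: "i = n + d" using False by (simp add: n_def)
      have "(\<Sum>l<d. c l * a (i + l)) = (\<Sum>l<d. \<Sum>k<d. c l * (q k * a (n + l + k)))"
      proof (rule sum.cong)
        fix l
        have "a (i + l) = (\<Sum>k<d. q k * a (n + l + k))"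
          using q [of "n + l"] by (simp add: i ac_simps)
        then show "c l * a (i + l) = (\<Sum>k<d. c l * (q k * a (n + l + k)))"
          by (simp add: sum_distrib_left)
      qed simp
      also have "\<dots> = (\<Sum>k<d. q k * (\<Sum>l<d. c l * a (n + k + l)))"
        by (subst sum.swap) (simp add: sum_distrib_left ac_simps)
      also have "\<dots> = 0"
        using less i by simp
      finally show ?thesis .
    qed (use c in simp)
  qed
  have "a (n + L) = (\<Sum>l<L. (- c l / c L) * a (n + l))" for n
  proof -
    have "(\<Sum>l<d. c l * a (n + l)) = (\<Sum>l\<le>L. c l * a (n + l))"
      by (rule sum.mono_neutral_right) (use L above in auto)
    then have "c L * a (n + L) = - (\<Sum>l<L. c l * a (n + l))"
      using c0 [of n] by (simp add: lessThan_Suc_atMost [symmetric])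
    then have "a (n + L) = - (\<Sum>l<L. c l * a (n + l)) / c L"
      using L by (simp add: field_simps)
    then show ?thesis
      by (simp add: sum_divide_distrib sum_negf [symmetric])
  qed
  then have "\<exists>q. \<forall>n. a (n + L) = (\<Sum>l<L. q l * a (n + l))"
    by (intro exI [of _ "\<lambda>l. - c l / c L"] allI)
  then have "rational_degree_at_most (Abs_fps a) (int L)"
    by (simp add: rational_degree_at_most_iff_recurrence)
  then have "rational_degree_at_most (Abs_fps a) (int d - 1)"
    by (rule rational_degree_at_most_mono) (use L in simp)
  with G show False by (simp add: rational_of_degree_def)
qed

section \<open>Lower bound on the buffer size\<close>

lemma mat_apply_toeplitz:
  "mat_apply (toeplitz a) z t = (\<Sum>j\<le>t. a (t - j) * z j)"
proof -
  have "mat_apply (toeplitz a) z t = (\<Sum>j\<le>t. toeplitz a t j * z j)"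
    unfolding mat_apply_def by (rule suminf_finite) (auto simp: toeplitz_def)
  then show ?thesis by (simp add: toeplitz_def)
qed

lemma bufsize_lower_bound:
  assumes G: "rational_of_degree (Abs_fps a) d"
    and A: "streaming_algorithm A" "computes_upto A (toeplitz a) \<tau>"
    and t: "t < d" "enat (t + d - 1) \<le> \<tau>"
  shows "Suc t \<le> bufsize A t"
proof (rule continuous_injective_Euclidean_space_dim_le)
  show "continuous_map (Euclidean_space (Suc t)) (Euclidean_space (bufsize A t)) (\<lambda>z. buffer A z t)"
    using A by (simp add: streaming_algorithm_def)
  show "inj_on (\<lambda>z. buffer A z t) (topspace (Euclidean_space (Suc t)))"
  proof (rule inj_onI)
    fix z w
    assume "z \<in> topspace (Euclidean_space (Suc t))" "w \<in> topspace (Euclidean_space (Suc t))"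
      and eq: "buffer A z t = buffer A w t"
    then have z: "\<And>i. t < i \<Longrightarrow> z i = 0" and w: "\<And>i. t < i \<Longrightarrow> w i = 0"
      by (auto simp: topspace_Euclidean_space)
    \<comment> \<open>Both inputs are zero after time \<open>t\<close>, so equal buffers at time
      \<open>t\<close> receive the same updates from then on.\<close>
    have beq: "buffer A z (t + i) = buffer A w (t + i)" for i
      by (induction i) (use eq z w in auto)
    \<comment> \<open>The difference of the inputs, read backwards in time and padded with zeros to
      length \<open>d\<close>: the input at time \<open>t - l\<close> contributes
      \<open>a (i + l)\<close> to the output at time \<open>t + i\<close>.\<close>
    define c where "c l = (if l \<le> t then z (t - l) - w (t - l) else 0)" for l
    have "(\<Sum>l<d. c l * a (i + l)) = 0" if "i < d" for i
    proof -
      \<comment> \<open>The \<open>d\<close> rows of the Hankel system use the outputs at times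
        \<open>t\<close> to \<open>t + d - 1\<close>, which is what fixes the required
        horizon.\<close>
      have "enat (t + i) \<le> enat (t + d - 1)"
        using that by simp
      then have "enat (t + i) \<le> \<tau>" using t(2) order_trans by blast
      then have "mat_apply (toeplitz a) z (t + i) = mat_apply (toeplitz a) w (t + i)"
        using A(2) beq [of i] unfolding computes_upto_def by metis
      then have "(\<Sum>j\<le>t+i. a (t + i - j) * (z j - w j)) = 0"
        by (simp add: mat_apply_toeplitz right_diff_distrib sum_subtractf)
      moreover have "(\<Sum>j\<le>t+i. a (t + i - j) * (z j - w j)) = (\<Sum>j\<le>t. a (t + i - j) * (z j - w j))"
        by (rule sum.mono_neutral_right) (auto simp: z w)
      moreover have "\<dots> = (\<Sum>l\<le>t. c l * a (i + l))"
        by (rule sum.reindex_bij_witness [of _ "\<lambda>l. t - l" "\<lambda>l. t - l"])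
          (auto simp: c_def add.commute)
      moreover have "(\<Sum>l<d. c l * a (i + l)) = (\<Sum>l\<le>t. c l * a (i + l))"
        by (rule sum.mono_neutral_right) (use t in \<open>auto simp: c_def\<close>)
      ultimately show ?thesis by simp
    qed
    then have c0: "c l = 0" if "l < d" for l
      using Hankel_nonsingular [OF G, of c l] that by blast
    show "z = w"
    proof
      fix j
      show "z j = w j"
        using c0 [of "t - j"] t z [of j] w [of j] by (cases "j \<le> t") (auto simp: c_def)
    qed
  qed
qed

section \<open>Algorithms attaining the bounds\<close>

lemma shift_register_algorithm:
  assumes q: "\<And>n. a (n + d) = (\<Sum>l<d. q l * a (n + l))"
  obtains A where "streaming_algorithm A" "computes_upto A (toeplitz a) \<tau>" "bufsize A = (\<lambda>_. d)"
proof
  \<comment> \<open>Entry \<open>i\<close> forecasts the output at time \<open>t + i\<close> under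
    zero future input. An update shifts the forecasts by one, obtains the last one from the
    recurrence, and adds the response \<open>a i * x\<close> to the new input.\<close>
  define A where "A = \<lparr>bufsize = (\<lambda>_. d),
    update = (\<lambda>t s x i. if i < d
       then (if Suc i < d then s (Suc i) else \<Sum>l<d. q l * s l) + a i * x else 0),
    readout = (\<lambda>t s. if d = 0 then 0 else s 0)\<rparr>"
  have buf: "buffer A z t = (\<lambda>i. if i < d then \<Sum>j\<le>t. a (t - j + i) * z j else 0)" for z t
  proof (induction t)
    case 0
    then show ?case by (auto simp: A_def)
  next
    case (Suc t)
    have shift: "(if Suc i < d then \<Sum>j\<le>t. a (t - j + Suc i) * z j
           else \<Sum>l<d. q l * (\<Sum>j\<le>t. a (t - j + l) * z j)) = (\<Sum>j\<le>t. a (Suc t - j + i) * z j)"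
      if "i < d" for i
    proof (cases "Suc i < d")
      case True
      then show ?thesis by (auto intro!: sum.cong simp: Suc_diff_le)
    next
      case False
      have "(\<Sum>l<d. q l * (\<Sum>j\<le>t. a (t - j + l) * z j)) = (\<Sum>j\<le>t. (\<Sum>l<d. q l * a (t - j + l)) * z j)"
        by (simp add: sum_distrib_left sum_distrib_right mult.assoc) (rule sum.swap)
      also have "\<dots> = (\<Sum>j\<le>t. a (t - j + d) * z j)"
        by (simp only: q)
      also have "\<dots> = (\<Sum>j\<le>t. a (Suc t - j + i) * z j)"
      proof -
        have "d = Suc i" using False that by simp
        then show ?thesis by (auto intro!: sum.cong simp: Suc_diff_le)
      qed
      finally show ?thesis using False by simp
    qed
    show ?case
    proof
      fix i
      show "buffer A z (Suc t) i = (if i < d then \<Sum>j\<le>Suc t. a (Suc t - j + i) * z j else 0)"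
      proof (cases "i < d")
        case True
        have "buffer A z (Suc t) i = (if Suc i < d then \<Sum>j\<le>t. a (t - j + Suc i) * z j
           else \<Sum>l<d. q l * (\<Sum>j\<le>t. a (t - j + l) * z j)) + a i * z (Suc t)"
          using True by (simp add: Suc) (simp add: A_def)
        also have "\<dots> = (\<Sum>j\<le>Suc t. a (Suc t - j + i) * z j)"
          by (simp only: shift [OF True]) simp
        finally show ?thesis using True by simp
      qed (simp add: A_def)
    qed
  qed
  show "bufsize A = (\<lambda>_. d)" by (simp add: A_def)
  show "streaming_algorithm A"
    unfolding streaming_algorithm_def
  proof (intro conjI allI ballI)
    show "update A t s x \<in> topspace (Euclidean_space (bufsize A t))" for t s x
      by (simp add: A_def topspace_Euclidean_space)
    show "continuous_map (Euclidean_space (Suc t)) (Euclidean_space (bufsize A t)) (\<lambda>z. buffer A z t)" for t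
      unfolding buf \<open>bufsize A = (\<lambda>_. d)\<close> continuous_map_componentwise_Euclidean_space
      by (intro allI impI continuous_map_sum continuous_map_real_mult
          continuous_map_Euclidean_space_projection continuous_map_const [THEN iffD2]) auto
  qed
  show "computes_upto A (toeplitz a) \<tau>"
    unfolding computes_upto_def
  proof (intro allI impI)
    fix z t
    show "readout A t (buffer A z t) = mat_apply (toeplitz a) z t"
    proof (cases "d = 0")
      case True
      \<comment> \<open>With \<open>d = 0\<close> the buffer holds nothing, but the empty recurrence
        forces \<open>a\<close> to vanish, so the constant readout 0 is correct.\<close>
      then have "a n = 0" for n using q [of n] by simp
      with True show ?thesis by (simp add: A_def mat_apply_toeplitz)
    next
      case False
      then have "readout A t (buffer A z t) = buffer A z t 0" by (simp add: A_def)
      also have "\<dots> = mat_apply (toeplitz a) z t"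
        using False by (simp add: buf mat_apply_toeplitz)
      finally show ?thesis .
    qed
  qed
qed

lemma full_memory_algorithm:
  obtains A where "streaming_algorithm A" "computes_upto A (toeplitz a) \<tau>" "bufsize A = Suc"
proof
  define A where "A = \<lparr>bufsize = Suc,
    update = (\<lambda>t s x i. if i < Suc t then (if i = t then x else s i) else 0),
    readout = (\<lambda>t s. mat_apply (toeplitz a) s t)\<rparr>"
  have buf: "buffer A z t = (\<lambda>i. if i < Suc t then z i else 0)" for z t
    by (induction t) (auto simp: A_def)
  show "bufsize A = Suc" by (simp add: A_def)
  show "streaming_algorithm A"
    unfolding streaming_algorithm_def
  proof (intro conjI allI ballI)
    show "update A t s x \<in> topspace (Euclidean_space (bufsize A t))" for t s x
      by (simp add: A_def topspace_Euclidean_space)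
    show "continuous_map (Euclidean_space (Suc t)) (Euclidean_space (bufsize A t)) (\<lambda>z. buffer A z t)" for t
      unfolding buf \<open>bufsize A = Suc\<close> continuous_map_componentwise_Euclidean_space
      by (intro allI impI continuous_map_Euclidean_space_projection)
  qed
  \<comment> \<open>Row \<open>t\<close> involves only the inputs up to time \<open>t\<close>, so
    cutting \<open>z\<close> off after \<open>t\<close> does not change the output.\<close>
  have "readout A t (buffer A z t) = mat_apply (toeplitz a) z t" for z t
    by (simp add: buf) (simp add: A_def mat_apply_toeplitz)
  then show "computes_upto A (toeplitz a) \<tau>"
    by (simp add: computes_upto_def)
qed

section \<open>Exact space from matching bounds\<close>

lemma min_space_eqI:
  assumes "streaming_algorithm A" "computes_upto A M \<tau>" "Max (bufsize A ` {..t}) \<le> b"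
    and "\<And>B. streaming_algorithm B \<Longrightarrow> computes_upto B M \<tau> \<Longrightarrow> \<exists>s\<le>t. b \<le> bufsize B s"
  shows "min_space M t \<tau> = enat b"
proof (rule antisym)
  show "min_space M t \<tau> \<le> enat b"
    unfolding min_space_def by (rule Inf_lower) (use assms(1-3) in auto)
  show "enat b \<le> min_space M t \<tau>"
    unfolding min_space_def
  proof (rule Inf_greatest, clarify)
    fix c B
    assume B: "streaming_algorithm B" "computes_upto B M \<tau>" and c: "Max (bufsize B ` {..t}) \<le> c"
    obtain s where "s \<le> t" "b \<le> bufsize B s" using assms(4) B by blast
    moreover from this have "bufsize B s \<le> Max (bufsize B ` {..t})" by simp
    ultimately have "b \<le> c" using c by linarith
    then show "enat b \<le> enat c" by simp
  qed
qed

theorem theorem1p7: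
  fixes a :: "nat \<Rightarrow> real" and d :: nat
  assumes "rational_of_degree (Abs_fps a) d"
  shows "(\<forall>t. d \<le> t \<longrightarrow> min_space (toeplitz a) t \<infinity> = enat d) \<and>
         (\<forall>t. t < d \<longrightarrow> min_space (toeplitz a) t (enat (t + d - 1)) = enat (t + 1))"
proof (intro conjI allI impI)
  fix t assume "d \<le> t"
  obtain q where "\<And>n. a (n + d) = (\<Sum>l<d. q l * a (n + l))"
    using assms rational_degree_at_most_iff_recurrence [of a d] by (auto simp: rational_of_degree_def)
  then obtain A where A: "streaming_algorithm A" "computes_upto A (toeplitz a) \<infinity>" "bufsize A = (\<lambda>_. d)"
    by (rule shift_register_algorithm)
  show "min_space (toeplitz a) t \<infinity> = enat d"
  proof (rule min_space_eqI [OF A(1,2)])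
    show "Max (bufsize A ` {..t}) \<le> d" by (simp add: A(3))
    fix B assume B: "streaming_algorithm B" "computes_upto B (toeplitz a) \<infinity>"
    show "\<exists>s\<le>t. d \<le> bufsize B s"
    proof (cases d)
      case (Suc d')
      \<comment> \<open>The buffer must already have size \<open>d\<close> at time
        \<open>d - 1\<close>, the last time covered by the lower bound. This suffices because the
        maximum runs over all times up to \<open>t\<close>.\<close>
      then have "Suc d' \<le> bufsize B d'"
        by (intro bufsize_lower_bound [OF assms B]) auto
      with Suc \<open>d \<le> t\<close> show ?thesis by (intro exI [of _ d']) simp
    qed auto
  qed
next
  fix t assume t: "t < d"
  obtain A where A: "streaming_algorithm A" "computes_upto A (toeplitz a) (enat (t + d - 1))" "bufsize A = Suc"
    by (rule full_memory_algorithm)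
  show "min_space (toeplitz a) t (enat (t + d - 1)) = enat (t + 1)"
  proof (rule min_space_eqI [OF A(1,2)])
    show "Max (bufsize A ` {..t}) \<le> t + 1" by (simp add: A(3))
    fix B assume B: "streaming_algorithm B" "computes_upto B (toeplitz a) (enat (t + d - 1))"
    show "\<exists>s\<le>t. t + 1 \<le> bufsize B s"
      using bufsize_lower_bound [OF assms B t] by auto
  qed
qed

end
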